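(* Let $X$ be an observable with values $x$, let $\theta\in\mathbb{R}_+$ be the positive parameter to be estimated, and let $\pi$ be a prior. Suppose that the posterior density for $\theta$ is, for all $x$, scale invariant of the form $\theta|x\sim\frac{1}{\sigma(x)}f\big(\frac{\theta}{\sigma(x)}\big)$, $\theta\in\mathbb{R}_+$, where $\sigma(x)>0$ and $f$ does not depend on $x$, and that the first-stage loss for estimating $\theta$ is scale invariant, i.e. of the form $L(\theta,\hat\theta)=\rho\big(\frac{\hat\theta}{\theta}\big)$ with $\rho:\mathbb{R}\to\mathbb{R}_+$. Then: (a) the Bayes estimator $\hat\theta_\pi(X)$, whenever it exists, is of the form $\hat\theta_\pi(x)=k\,\sigma(x)$, $k$ being a constant (not depending on $x$); (b) the posterior distribution of the loss $\rho\big(\frac{\hat\theta_\pi(x)}{\theta}\big)$ is free of $x$ (does not depend on $x$); (c) the Bayes estimator $\hat L_\pi(x)$ of the loss $\rho\big(\frac{\hat\theta_\pi(x)}{\theta}\big)$ with respect to second-stage loss $W(L,\hat L)$ is, whenever it exists, free of $x$.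
   Context: All posterior quantities are with respect to the (possibly improper) prior $\pi$. A Bayes estimator $\hat\theta_\pi(x)$ of $\theta$ under first-stage loss $L(\theta,\hat\theta)$ minimizes in $\hat\theta$ the expected posterior loss $\mathbb{E}(L(\theta,\hat\theta)|x)$. A second-stage loss is a function $W(L,\hat L)\in[0,\infty)$ used for estimating the loss value $L=L(\theta,\hat\theta_\pi(x))$ by $\hat L$. A Bayes estimator $\hat L_\pi(x)$ of $L$ minimizes in $\hat L$ the expected posterior loss $\mathbb{E}(W(L,\hat L)|x)$, where the expectation is with respect to the posterior distribution of $\theta$ given $x$. *)

theory Defs
  imports "HOL-Probability.Probability"
begin

text \<open>The parameter space, the strictly positive reals with their Borel sets.\<close>

abbreviation pos_borel :: "real measure" where
  "pos_borel \<equiv> restrict_space borel {0<..}"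

text \<open>
  A prior \<open>\<pi>\<close> may be improper, so the marginal of the observation cannot be formed with the
  monadic bind for subprobability measures and is given by its values on measurable sets.
\<close>

definition marginal :: "real measure \<Rightarrow> (real \<Rightarrow> 'x measure) \<Rightarrow> 'x measure \<Rightarrow> 'x measure" where
  "marginal \<pi> P MX =
     measure_of (space MX) (sets MX) (\<lambda>B. \<integral>\<^sup>+\<theta>. emeasure (P \<theta>) B \<partial>\<pi>)"

text \<open>
  \<open>post\<close> is a posterior for the prior \<open>\<pi>\<close> and the sampling distributions \<open>P \<theta>\<close> if it disintegrates
  the joint measure \<open>\<pi>(d\<theta>) P\<^sub>\<theta>(dx)\<close> along its marginal in \<open>x\<close>. For a dominated model this is
  the posterior given by Bayes' formula.
\<close>

definition is_posterior ::
  "real measure \<Rightarrow> (real \<Rightarrow> 'x measure) \<Rightarrow> 'x measure \<Rightarrow> ('x \<Rightarrow> real measure) \<Rightarrow> bool" where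
  "is_posterior \<pi> P MX post \<longleftrightarrow>
     post \<in> MX \<rightarrow>\<^sub>M prob_algebra pos_borel \<and>
     (\<forall>A\<in>sets pos_borel. \<forall>B\<in>sets MX.
        (\<integral>\<^sup>+\<theta>\<in>A. emeasure (P \<theta>) B \<partial>\<pi>) =
        (\<integral>\<^sup>+x\<in>B. emeasure (post x) A \<partial>marginal \<pi> P MX))"

definition expected_loss :: "real measure \<Rightarrow> (real \<Rightarrow> real \<Rightarrow> real) \<Rightarrow> real \<Rightarrow> ennreal" where
  "expected_loss M loss a = (\<integral>\<^sup>+\<theta>. ennreal (loss \<theta> a) \<partial>M)"

text \<open>
  Speaking of \<^emph>\<open>the\<close> Bayes estimate presupposes that the minimizer over the set \<open>D\<close> of
  admissible estimates is unique: among several minimizers, one could be selected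
  differently for each observation.
\<close>

definition is_the_bayes_estimate ::
  "real measure \<Rightarrow> (real \<Rightarrow> real \<Rightarrow> real) \<Rightarrow> real set \<Rightarrow> real \<Rightarrow> bool" where
  "is_the_bayes_estimate M loss D a \<longleftrightarrow>
     is_arg_min (expected_loss M loss) (\<lambda>b. b \<in> D) a \<and>
     (\<forall>b. is_arg_min (expected_loss M loss) (\<lambda>b. b \<in> D) b \<longrightarrow> b = a)"

end

theory Submission imports Defs begin

text \<open>
  The posterior given \<open>x\<close> is the image of one fixed measure, with density \<open>f\<close>, under
  multiplication by \<open>\<sigma> x\<close> (\<open>scale_family_eq_distr\<close>). Measured in units of \<open>\<sigma> x\<close>, the
  decision problem is therefore the same for every \<open>x\<close>: the loss depends only on the ratio of
  estimate and parameter, so the posterior risk of \<open>t\<close> is a fixed function of \<open>t / \<sigma> x\<close>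
  (\<open>scaled_expected_loss\<close>). Since its minimizer is unique, it has the form \<open>k * \<sigma> x\<close> with a common
  \<open>k\<close>. The scale then cancels in the loss incurred by this estimate, which is distributed as
  \<open>\<rho> (k / u)\<close> with \<open>u\<close> drawn from the standard posterior. Finally, the
  second-stage risk depends on \<open>x\<close> only through the law of that loss
  (\<open>expected_loss_distr\<close>), so its unique minimizer is also common to all \<open>x\<close>.
\<close>

definition scale_family :: "(real \<Rightarrow> real) \<Rightarrow> real \<Rightarrow> real measure" where
  "scale_family f s =
     density (restrict_space lborel {0<..}) (\<lambda>\<theta>. ennreal (1 / s * f (\<theta> / s)))"

lemma sets_scale_family [measurable_cong]: "sets (scale_family f s) = sets pos_borel"
  by (simp add: scale_family_def cong: sets_restrict_space_cong)

lemma space_scale_family: "space (scale_family f s) = {0<..}"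
  by (simp add: scale_family_def space_restrict_space)

lemma divide_pos_borel_measurable:
  fixes c :: real
  shows "(\<lambda>u. c / u) \<in> borel_measurable pos_borel"
  by (rule measurable_restrict_space1) measurable

lemma mult_pos_borel_measurable:
  fixes s :: real
  assumes "s > 0"
  shows "(\<lambda>u. s * u) \<in> pos_borel \<rightarrow>\<^sub>M pos_borel"
  using assms by (intro measurable_restrict_space3) auto

text \<open>
  Substituting \<open>\<theta> = s * u\<close> in the integral over a measurable set, the Jacobian cancels the
  normalization \<open>1 / s\<close> of the density.
\<close>

lemma scale_family_eq_distr:
  assumes f: "f \<in> borel_measurable pos_borel" and s: "s > 0"
  shows "scale_family f s = distr (scale_family f 1) pos_borel (\<lambda>u. s * u)"
proof (rule measure_eqI)
  fix A assume "A \<in> sets (scale_family f s)"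
  then have A: "A \<in> sets pos_borel" by (simp add: sets_scale_family)
  then have A': "A \<in> sets borel" "A \<subseteq> {0<..}"
    by (auto simp: sets_restrict_space_iff)
  have meas_scaled: "(\<lambda>\<theta>. ennreal (1 / r * f (\<theta> / r))) \<in> borel_measurable pos_borel"
    if "r > 0" for r
  proof -
    have "(\<lambda>\<theta>. f (inverse r * \<theta>)) \<in> borel_measurable pos_borel"
      by (rule measurable_compose[OF mult_pos_borel_measurable f]) (use that in simp)
    then have "(\<lambda>\<theta>. f (\<theta> / r)) \<in> borel_measurable pos_borel"
      by (simp add: divide_inverse mult.commute)
    then show ?thesis by measurable
  qed
  have em: "emeasure (scale_family f r) B =
      (\<integral>\<^sup>+\<theta>. ennreal (1 / r * f (\<theta> / r)) * indicator B \<theta> \<partial>lborel)"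
    if "r > 0" "B \<in> sets pos_borel" for r B
  proof -
    have sub: "B \<subseteq> {0<..}" using that by (auto simp: sets_restrict_space_iff)
    have "emeasure (scale_family f r) B = (\<integral>\<^sup>+\<theta>. ennreal (1 / r * f (\<theta> / r)) * indicator B \<theta>
        \<partial>restrict_space lborel {0<..})"
      unfolding scale_family_def
      by (rule emeasure_density)
        (use that meas_scaled in \<open>auto cong: measurable_cong_sets sets_restrict_space_cong\<close>)
    also have "\<dots> = (\<integral>\<^sup>+\<theta>. ennreal (1 / r * f (\<theta> / r)) * indicator B \<theta> * indicator {0<..} \<theta> \<partial>lborel)"
      by (rule nn_integral_restrict_space) simp
    also have "\<dots> = (\<integral>\<^sup>+\<theta>. ennreal (1 / r * f (\<theta> / r)) * indicator B \<theta> \<partial>lborel)"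
      using sub by (intro nn_integral_cong) (auto split: split_indicator)
    finally show ?thesis .
  qed
  define B where "B = (\<lambda>u. s * u) -` A \<inter> {0<..}"
  have B: "B \<in> sets pos_borel"
    using measurable_sets[OF mult_pos_borel_measurable[OF s] A]
    by (simp add: B_def space_restrict_space)
  have ind: "indicator A (s * u) = (indicator B u :: ennreal)" for u
    using A'(2) s by (auto simp: B_def indicator_def zero_less_mult_iff)
  \<comment> \<open>\<open>f\<close> is measurable on the positive half-line only, and \<open>A\<close> cuts off the rest\<close>
  have integrand: "(\<lambda>\<theta>. ennreal (1 / s * f (\<theta> / s)) * indicator A \<theta>) \<in> borel_measurable borel"
  proof -
    have "(\<lambda>\<theta>. ennreal (1 / s * f (\<theta> / s)) * indicator {0<..} \<theta>) \<in> borel_measurable borel"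
      using meas_scaled[OF s] by (subst borel_measurable_restrict_space_iff_ennreal[symmetric]) auto
    then have "(\<lambda>\<theta>. ennreal (1 / s * f (\<theta> / s)) * indicator {0<..} \<theta> * indicator A \<theta>)
        \<in> borel_measurable borel"
      using A'(1) by measurable
    moreover have "indicator {0<..} \<theta> * indicator A \<theta> = (indicator A \<theta> :: ennreal)" for \<theta>
      using A'(2) by (auto split: split_indicator)
    ultimately show ?thesis by (simp add: mult.assoc)
  qed
  have "emeasure (scale_family f s) A =
      (\<integral>\<^sup>+\<theta>. ennreal (1 / s * f (\<theta> / s)) * indicator A \<theta> \<partial>lborel)"
    by (rule em[OF s A])
  also have "\<dots> = ennreal s * (\<integral>\<^sup>+u. ennreal (1 / s * f u) * indicator B u \<partial>lborel)"
    using s by (subst nn_integral_real_affine[OF integrand, where c = s and t = 0]) (auto simp: ind)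
  also have "\<dots> = (\<integral>\<^sup>+u. ennreal s * (ennreal (1 / s * f u) * indicator B u) \<partial>lborel)"
  proof (rule nn_integral_cmult[symmetric])
    have "(\<lambda>u. ennreal (1 / s * f (s * u / s)) * indicator A (s * u)) \<in> borel_measurable lborel"
      using measurable_compose[OF _ integrand, of "\<lambda>u. s * u" lborel] by simp
    then show "(\<lambda>u. ennreal (1 / s * f u) * indicator B u) \<in> borel_measurable lborel"
      using s by (simp add: ind)
  qed
  also have "\<dots> = (\<integral>\<^sup>+u. ennreal (1 / 1 * f (u / 1)) * indicator B u \<partial>lborel)"
    using s by (intro nn_integral_cong) (simp flip: mult.assoc ennreal_mult')
  also have "\<dots> = emeasure (scale_family f 1) B"
    by (rule em[symmetric]) (use B in simp_all)
  also have "\<dots> = emeasure (distr (scale_family f 1) pos_borel (\<lambda>u. s * u)) A"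
    using A mult_pos_borel_measurable[OF s]
    by (subst emeasure_distr)
      (auto simp: B_def space_scale_family sets_scale_family cong: measurable_cong_sets)
  finally show "emeasure (scale_family f s) A =
      emeasure (distr (scale_family f 1) pos_borel (\<lambda>u. s * u)) A" .
qed (simp add: sets_scale_family)

text \<open>Scale invariance of the loss turns the factor \<open>s\<close> on the parameter into \<open>1 / s\<close> on the estimate.\<close>

lemma scaled_expected_loss:
  assumes f: "f \<in> borel_measurable pos_borel" and s: "s > 0"
    and \<rho>: "\<rho> \<in> borel_measurable borel"
    and L: "\<And>\<theta> t. \<theta> > 0 \<Longrightarrow> L \<theta> t = \<rho> (t / \<theta>)"
  shows "expected_loss (scale_family f s) L t =
    expected_loss (scale_family f 1) (\<lambda>u b. \<rho> (b / u)) (t / s)"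
proof -
  have [measurable]: "(\<lambda>\<theta>. \<rho> (t / \<theta>)) \<in> borel_measurable pos_borel"
    by (rule measurable_compose[OF divide_pos_borel_measurable \<rho>])
  have [measurable]: "(\<lambda>u. s * u) \<in> scale_family f 1 \<rightarrow>\<^sub>M pos_borel"
    using mult_pos_borel_measurable[OF s]
    by (simp add: sets_scale_family cong: measurable_cong_sets)
  have "expected_loss (scale_family f s) L t =
      (\<integral>\<^sup>+\<theta>. ennreal (\<rho> (t / \<theta>)) \<partial>scale_family f s)"
    unfolding expected_loss_def
    by (intro nn_integral_cong) (simp add: L space_scale_family)
  also have "\<dots> = (\<integral>\<^sup>+u. ennreal (\<rho> (t / (s * u))) \<partial>scale_family f 1)"
    by (subst scale_family_eq_distr[OF f s], rule nn_integral_distr) measurable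
  finally show ?thesis by (simp add: expected_loss_def)
qed

text \<open>Likewise the scale cancels in the law of the loss of an estimate proportional to it.\<close>

lemma distr_scaled_loss:
  assumes f: "f \<in> borel_measurable pos_borel" and s: "s > 0"
    and \<rho>: "\<rho> \<in> borel_measurable borel"
  shows "distr (scale_family f s) borel (\<lambda>\<theta>. \<rho> (k * s / \<theta>)) =
    distr (scale_family f 1) borel (\<lambda>u. \<rho> (k / u))"
proof -
  have meas: "(\<lambda>\<theta>. \<rho> (k * s / \<theta>)) \<in> borel_measurable pos_borel"
    by (rule measurable_compose[OF divide_pos_borel_measurable \<rho>])
  have scale: "(\<lambda>u. s * u) \<in> scale_family f 1 \<rightarrow>\<^sub>M pos_borel"
    using mult_pos_borel_measurable[OF s]
    by (simp add: sets_scale_family cong: measurable_cong_sets)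
  have "distr (scale_family f s) borel (\<lambda>\<theta>. \<rho> (k * s / \<theta>)) =
      distr (scale_family f 1) borel ((\<lambda>\<theta>. \<rho> (k * s / \<theta>)) \<circ> (\<lambda>u. s * u))"
    by (subst scale_family_eq_distr[OF f s], rule distr_distr[OF meas scale])
  also have "(\<lambda>\<theta>. \<rho> (k * s / \<theta>)) \<circ> (\<lambda>u. s * u) = (\<lambda>u. \<rho> (k / u))"
    using s by (simp add: fun_eq_iff)
  finally show ?thesis .
qed

text \<open>
  A loss that sees the parameter only through \<open>g \<theta>\<close> has a risk that sees the posterior only through
  the law of \<open>g\<close>; for the second-stage loss, \<open>g\<close> is the first-stage loss.
\<close>

lemma expected_loss_distr:
  assumes "g \<in> borel_measurable M" and "(\<lambda>v. W v l) \<in> borel_measurable borel"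
  shows "expected_loss M (\<lambda>\<theta>. W (g \<theta>)) l = expected_loss (distr M borel g) W l"
  unfolding expected_loss_def using assms by (subst nn_integral_distr) auto

lemma is_the_bayes_estimate_cong:
  assumes "\<And>b. b \<in> D \<Longrightarrow> expected_loss M l b = expected_loss N l' b"
  shows "is_the_bayes_estimate M l D a \<longleftrightarrow> is_the_bayes_estimate N l' D a"
proof -
  have "is_arg_min (expected_loss M l) (\<lambda>b. b \<in> D) b \<longleftrightarrow>
      is_arg_min (expected_loss N l') (\<lambda>b. b \<in> D) b" for b
    using assms by (auto simp: is_arg_min_def)
  then show ?thesis by (simp add: is_the_bayes_estimate_def)
qed

lemma is_the_bayes_estimate_unique:
  assumes "is_the_bayes_estimate M l D a" "is_the_bayes_estimate M l D b"
  shows "a = b"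
  using assms by (auto simp: is_the_bayes_estimate_def)

text \<open>
  Division by \<open>s\<close> permutes the real line, so it matches the minimizers over all real estimates
  one to one; uniqueness is carried over as well.
\<close>

lemma is_the_bayes_estimate_rescale:
  fixes s :: real
  assumes s: "s > 0" and eq: "\<And>b. expected_loss M l b = expected_loss N l' (b / s)"
    and est: "is_the_bayes_estimate M l UNIV a"
  shows "is_the_bayes_estimate N l' UNIV (a / s)"
proof -
  have eq': "expected_loss N l' c = expected_loss M l (c * s)" for c
    using s by (simp add: eq)
  have "is_arg_min (expected_loss N l') (\<lambda>b. b \<in> UNIV) c \<longleftrightarrow>
      is_arg_min (expected_loss M l) (\<lambda>b. b \<in> UNIV) (c * s)" for c
  proof -
    have "(\<forall>b. \<not> expected_loss N l' b < expected_loss N l' c) \<longleftrightarrow>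
        (\<forall>b. \<not> expected_loss M l b < expected_loss M l (c * s))"
      unfolding eq'[of c] by (metis eq eq')
    then show ?thesis by (simp add: is_arg_min_def)
  qed
  then show ?thesis
    using est s by (auto simp: is_the_bayes_estimate_def field_simps)
qed

theorem theorem2:
  fixes MX :: "'x measure"
    and \<pi> :: "real measure"
    and P :: "real \<Rightarrow> 'x measure"
    and post :: "'x \<Rightarrow> real measure"
    and \<sigma> :: "'x \<Rightarrow> real"
    and f \<rho> :: "real \<Rightarrow> real"
    and L W :: "real \<Rightarrow> real \<Rightarrow> real"
    and D :: "real set"
  assumes prior: "sets \<pi> = sets pos_borel"
    and model: "P \<in> pos_borel \<rightarrow>\<^sub>M prob_algebra MX"
    and posterior: "is_posterior \<pi> P MX post"
    and \<sigma>_pos: "\<And>x. x \<in> space MX \<Longrightarrow> \<sigma> x > 0"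
    and f_meas: "f \<in> borel_measurable pos_borel"
    and f_nonneg: "\<And>u. u > 0 \<Longrightarrow> f u \<ge> 0"
    and posterior_density: "\<And>x. x \<in> space MX \<Longrightarrow>
      post x = density (restrict_space lborel {0<..}) (\<lambda>\<theta>. ennreal (1 / \<sigma> x * f (\<theta> / \<sigma> x)))"
    and \<rho>_meas: "\<rho> \<in> borel_measurable borel"
    and \<rho>_nonneg: "\<And>t. \<rho> t \<ge> 0"
    and first_stage_loss: "\<And>\<theta> t. \<theta> > 0 \<Longrightarrow> L \<theta> t = \<rho> (t / \<theta>)"
    and W_meas: "\<And>l. l \<in> D \<Longrightarrow> (\<lambda>v. W v l) \<in> borel_measurable borel"
    and W_nonneg: "\<And>v l. v \<ge> 0 \<Longrightarrow> l \<in> D \<Longrightarrow> W v l \<ge> 0"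
  shows
    "\<forall>\<theta>hat. (\<forall>x\<in>space MX. is_the_bayes_estimate (post x) L UNIV (\<theta>hat x)) \<longrightarrow>
       (\<exists>k. \<forall>x\<in>space MX. \<theta>hat x = k * \<sigma> x) \<and>
       (\<exists>Q. \<forall>x\<in>space MX. distr (post x) borel (\<lambda>\<theta>. \<rho> (\<theta>hat x / \<theta>)) = Q) \<and>
       (\<forall>Lhat. (\<forall>x\<in>space MX.
            is_the_bayes_estimate (post x) (\<lambda>\<theta> l. W (\<rho> (\<theta>hat x / \<theta>)) l) D (Lhat x)) \<longrightarrow>
          (\<exists>c. \<forall>x\<in>space MX. Lhat x = c))"
proof (cases "space MX = {}")
  case True
  then show ?thesis by simp
next
  case False
  then obtain x0 where x0: "x0 \<in> space MX" by blast
  let ?F = "scale_family f 1"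
  have post: "post x = scale_family f (\<sigma> x)" if "x \<in> space MX" for x
    using posterior_density[OF that] by (simp add: scale_family_def)
  show ?thesis
  proof (intro allI impI)
    fix \<theta>hat assume est: "\<forall>x\<in>space MX. is_the_bayes_estimate (post x) L UNIV (\<theta>hat x)"
    \<comment> \<open>the estimate in units of the scale solves one and the same problem for every observation\<close>
    have standard: "is_the_bayes_estimate ?F (\<lambda>u b. \<rho> (b / u)) UNIV (\<theta>hat x / \<sigma> x)"
      if x: "x \<in> space MX" for x
      by (rule is_the_bayes_estimate_rescale[OF \<sigma>_pos[OF x] _ est[rule_format, OF x]],
          unfold post[OF x],
          rule scaled_expected_loss[OF f_meas \<sigma>_pos[OF x] \<rho>_meas first_stage_loss])
    define k where "k = \<theta>hat x0 / \<sigma> x0"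
    have k: "\<theta>hat x = k * \<sigma> x" if x: "x \<in> space MX" for x
      using is_the_bayes_estimate_unique[OF standard[OF x] standard[OF x0]] \<sigma>_pos[OF x]
      by (simp add: k_def field_simps)
    define Q where "Q = distr ?F borel (\<lambda>u. \<rho> (k / u))"
    have Q: "distr (post x) borel (\<lambda>\<theta>. \<rho> (\<theta>hat x / \<theta>)) = Q" if x: "x \<in> space MX" for x
      unfolding post[OF x] k[OF x] Q_def
      by (rule distr_scaled_loss[OF f_meas \<sigma>_pos[OF x] \<rho>_meas])
    have meas: "(\<lambda>\<theta>. \<rho> (\<theta>hat x / \<theta>)) \<in> borel_measurable (post x)" if x: "x \<in> space MX" for x
      using measurable_compose[OF divide_pos_borel_measurable \<rho>_meas]
      by (simp add: post[OF x] sets_scale_family cong: measurable_cong_sets)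
    have second_stage: "is_the_bayes_estimate (post x) (\<lambda>\<theta> l. W (\<rho> (\<theta>hat x / \<theta>)) l) D a \<longleftrightarrow>
        is_the_bayes_estimate Q W D a" if x: "x \<in> space MX" for x a
      by (rule is_the_bayes_estimate_cong)
        (simp add: expected_loss_distr[OF meas[OF x] W_meas] Q[OF x])
    show "(\<exists>k. \<forall>x\<in>space MX. \<theta>hat x = k * \<sigma> x) \<and>
       (\<exists>Q. \<forall>x\<in>space MX. distr (post x) borel (\<lambda>\<theta>. \<rho> (\<theta>hat x / \<theta>)) = Q) \<and>
       (\<forall>Lhat. (\<forall>x\<in>space MX.
            is_the_bayes_estimate (post x) (\<lambda>\<theta> l. W (\<rho> (\<theta>hat x / \<theta>)) l) D (Lhat x)) \<longrightarrow>
          (\<exists>c. \<forall>x\<in>space MX. Lhat x = c))"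
    proof (intro conjI allI impI)
      fix Lhat assume "\<forall>x\<in>space MX.
            is_the_bayes_estimate (post x) (\<lambda>\<theta> l. W (\<rho> (\<theta>hat x / \<theta>)) l) D (Lhat x)"
      then have "is_the_bayes_estimate Q W D (Lhat x)" if "x \<in> space MX" for x
        using that second_stage by blast
      then show "\<exists>c. \<forall>x\<in>space MX. Lhat x = c"
        using is_the_bayes_estimate_unique x0 by blast
    qed (use k Q in blast)+
  qed
qed

end
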